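(* Let $M$ be a CG-lattice $L$-module and let $N$ be a proper element of $M$. Then the following statements are equivalent: (1) $N$ is classical prime. (2) For every $a,b\in L$, either $(N:ab)=(N:a)$ or $(N:ab)=(N:b)$. (3) For every $r,s\in L_\ast$ and $K\in M_\ast$, if $rsK\leqslant N$ then either $rK\leqslant N$ or $sK\leqslant N$.
   Context: A multiplicative lattice $L$ is a complete lattice (least element $0$, greatest element $1$) with a commutative, associative multiplication that distributes over arbitrary joins and has $1$ as identity. An element $a$ of a complete lattice is compact if $a\leqslant \bigvee X$ implies $a\leqslant x_1\vee\cdots\vee x_n$ for finitely many $x_i\in X$; $L_\ast$ is the set of compact elements of $L$. Standing assumption: every element of $L$ is a join of compact elements of $L$, $1$ is compact, and finite products of compact elements of $L$ are compact. An $L$-module $M$ is a complete lattice (least element $O_M$, greatest element $I_M$) with a multiplication $L\times M\to M$, $(a,A)\mapsto aA$, such that $(\bigvee_\alpha a_\alpha)A=\bigvee_\alpha a_\alpha A$, $a(\bigvee_\alpha A_\alpha)=\bigvee_\alpha aA_\alpha$, $(ab)A=a(bA)$, $1A=A$, $0A=O_M$. $M_\ast$ is the set of compact elements of $M$; $M$ is a CG-lattice $L$-module if each element of $M$ is a join of compact elements of $M$. For $N\in M$ and $a\in L$, $(N:a)=\bigvee\{X\in M\mid aX\leqslant N\}\in M$. $N\in M$ is proper if $N<I_M$. A proper $N\in M$ is classical prime if for all $K\in M$, $a,b\in L$, $abK\leqslant N$ implies $aK\leqslant N$ or $bK\leqslant N$. *)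

theory Defs
  imports Main
begin

text \<open>
  Multiplicative lattices and their modules are carried by whole types of class
  \<^class>\<open>complete_lattice\<close>, so \<open>0\<close>, \<open>1\<close> of \<open>L\<close> are \<open>bot\<close>, \<open>top\<close>, and \<open>O\<^sub>M\<close>, \<open>I\<^sub>M\<close> are
  \<open>bot\<close>, \<open>top\<close> of the module type.
\<close>

definition (in complete_lattice) compact_elem :: "'a \<Rightarrow> bool" where
  "compact_elem a \<longleftrightarrow> (\<forall>X. a \<le> Sup X \<longrightarrow> (\<exists>F. finite F \<and> F \<subseteq> X \<and> a \<le> Sup F))"

definition (in complete_lattice) compactly_generated :: "'a itself \<Rightarrow> bool" where
  "compactly_generated _ \<longleftrightarrow> (\<forall>a::'a. \<exists>X. (\<forall>x\<in>X. compact_elem x) \<and> a = Sup X)"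

text \<open>
  The law \<open>mult_Sup\<close> includes the empty join.  This adds nothing to the version for nonempty joins:
  there \<open>*\<close> is monotone, so \<open>a * bot \<le> 1 * bot = bot\<close>.  The same remark applies to \<open>smult_Sup\<close>
  in the locale \<open>L_module\<close> below.
\<close>

class multiplicative_lattice = complete_lattice + comm_monoid_mult +
  assumes one_eq_top: "1 = top"
    and mult_Sup: "a * Sup X = Sup ((\<lambda>x. a * x) ` X)"

class cg_multiplicative_lattice = multiplicative_lattice +
  assumes compactly_generated: "compactly_generated TYPE('a)"
    and compact_elem_one: "compact_elem 1"
    and compact_elem_mult: "compact_elem a \<Longrightarrow> compact_elem b \<Longrightarrow> compact_elem (a * b)"

locale L_module =
  fixes smult :: "'l::multiplicative_lattice \<Rightarrow> 'm::complete_lattice \<Rightarrow> 'm"  (infixr \<open>\<cdot>\<close> 75)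
  assumes Sup_smult: "Sup X \<cdot> A = Sup ((\<lambda>a. a \<cdot> A) ` X)"
    and smult_Sup: "a \<cdot> Sup Y = Sup ((\<lambda>A. a \<cdot> A) ` Y)"
    and mult_smult: "(a * b) \<cdot> A = a \<cdot> (b \<cdot> A)"
    and one_smult: "1 \<cdot> A = A"
    and bot_smult: "bot \<cdot> A = bot"

locale cg_L_module = L_module smult
  for smult :: "'l::multiplicative_lattice \<Rightarrow> 'm::complete_lattice \<Rightarrow> 'm" +
  assumes module_compactly_generated: "compactly_generated TYPE('m)"

text \<open>\<open>residual smult N a\<close> is \<open>(N : a)\<close> with values in the module, not in \<open>L\<close>.\<close>

definition residual ::
    "('l::multiplicative_lattice \<Rightarrow> 'm::complete_lattice \<Rightarrow> 'm) \<Rightarrow> 'm \<Rightarrow> 'l \<Rightarrow> 'm" where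
  "residual smult N a = Sup {X. smult a X \<le> N}"

definition proper_elem :: "'m::complete_lattice \<Rightarrow> bool" where
  "proper_elem N \<longleftrightarrow> N < top"

definition classical_prime ::
    "('l::multiplicative_lattice \<Rightarrow> 'm::complete_lattice \<Rightarrow> 'm) \<Rightarrow> 'm \<Rightarrow> bool" where
  "classical_prime smult N \<longleftrightarrow> proper_elem N \<and>
     (\<forall>K a b. smult (a * b) K \<le> N \<longrightarrow> smult a K \<le> N \<or> smult b K \<le> N)"

end

theory Submission
  imports Defs
begin

text \<open>
  Since \<open>X \<le> (N : a)\<close> iff \<open>a X \<le> N\<close>, applying primality to the single element \<open>(N : ab)\<close>
  gives (2).  For (3) implies (1), failures \<open>a K \<le> N\<close> and \<open>b K \<le> N\<close> are witnessed by compact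
  elements \<open>r \<le> a\<close>, \<open>s \<le> b\<close> and \<open>K\<^sub>1, K\<^sub>2 \<le> K\<close>; the compact element \<open>K\<^sub>1 \<squnion> K\<^sub>2\<close> then
  witnesses both at once.
\<close>

text \<open>The union of the finite subfamilies found for \<open>a\<close> and for \<open>b\<close>
  serves for their join.\<close>

lemma compact_elem_sup:
  fixes a b :: "'a::complete_lattice"
  assumes "compact_elem a" and "compact_elem b"
  shows "compact_elem (sup a b)"
  unfolding compact_elem_def
proof (intro allI impI)
  fix X assume "sup a b \<le> Sup X"
  then obtain F G where F: "finite F" "F \<subseteq> X" "a \<le> Sup F" and G: "finite G" "G \<subseteq> X" "b \<le> Sup G"
    using assms unfolding compact_elem_def by (metis le_sup_iff)
  then have "finite (F \<union> G)" "F \<union> G \<subseteq> X" "sup a b \<le> Sup (F \<union> G)"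
    by (simp_all add: Sup_union_distrib le_supI1 le_supI2)
  then show "\<exists>F. finite F \<and> F \<subseteq> X \<and> sup a b \<le> Sup F" by blast
qed

context L_module
begin

lemma smult_sup: "a \<cdot> sup A B = sup (a \<cdot> A) (a \<cdot> B)"
  using smult_Sup[of a "{A, B}"] by simp

lemma sup_smult: "sup a b \<cdot> A = sup (a \<cdot> A) (b \<cdot> A)"
  using Sup_smult[of "{a, b}" A] by simp

lemma smult_mono:
  assumes "a \<le> b" and "A \<le> B"
  shows "a \<cdot> A \<le> b \<cdot> B"
proof -
  \<comment> \<open>An inequality \<open>a \<le> b\<close> means \<open>b = sup a b\<close>, so
    monotonicity in each argument comes from distributing over a binary join.\<close>
  have "b \<cdot> A = sup (a \<cdot> A) (b \<cdot> A)"
    using sup_smult[of a b A] assms(1) by (simp add: sup_absorb2)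
  moreover have "b \<cdot> B = sup (b \<cdot> A) (b \<cdot> B)"
    using smult_sup[of b A B] assms(2) by (simp add: sup_absorb2)
  ultimately show ?thesis by (metis order_trans sup_ge1)
qed

text \<open>Multiplication by \<open>a\<close> preserves joins, so the join of all \<open>X\<close>
  with \<open>a \<cdot> X \<le> N\<close> is itself such an \<open>X\<close>. Hence
  \<open>residual smult N\<close> at \<open>a\<close> is the value at \<open>N\<close> of the right
  adjoint of multiplication by \<open>a\<close>.\<close>

lemma le_residual_iff: "X \<le> residual smult N a \<longleftrightarrow> a \<cdot> X \<le> N"
proof
  assume "X \<le> residual smult N a"
  then have "a \<cdot> X \<le> a \<cdot> residual smult N a" by (rule smult_mono[OF order_refl])
  also have "\<dots> \<le> N" by (auto simp: residual_def smult_Sup intro: Sup_least)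
  finally show "a \<cdot> X \<le> N" .
qed (auto simp: residual_def intro: Sup_upper)

lemma residual_le_residual_mult: "residual smult N a \<le> residual smult N (a * b)"
proof -
  have "b \<cdot> residual smult N a \<le> residual smult N a"
    \<comment> \<open>The identity is the greatest element, so multiplying by \<open>b\<close> can
      only decrease. The product \<open>1 \<cdot> X\<close> has to be simplified before
      \<open>1\<close> is rewritten to \<open>top\<close>.\<close>
    using smult_mono[of b 1 "residual smult N a"] by (simp add: one_smult) (simp add: one_eq_top)
  then show ?thesis by (simp add: le_residual_iff mult_smult)
qed

lemma classical_prime_iff_residual:
  assumes "proper_elem N"
  shows "classical_prime smult N \<longleftrightarrow>
    (\<forall>a b. residual smult N (a * b) = residual smult N a \<or>
           residual smult N (a * b) = residual smult N b)"
proof -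
  \<comment> \<open>One inclusion always holds, so equality amounts to the reverse one, which the
    adjunction turns into a bound by \<open>N\<close>.\<close>
  have *: "residual smult N (a * b) = residual smult N c \<longleftrightarrow> c \<cdot> residual smult N (a * b) \<le> N"
    if "c = a \<or> c = b" for a b c
  proof -
    have "residual smult N c \<le> residual smult N (a * b)"
      using that residual_le_residual_mult[of N a b] residual_le_residual_mult[of N b a]
      by (auto simp: mult.commute)
    then show ?thesis
      by (auto simp: le_residual_iff[symmetric])
  qed
  show ?thesis
  proof
    assume "classical_prime smult N"
    then have "a \<cdot> residual smult N (a * b) \<le> N \<or> b \<cdot> residual smult N (a * b) \<le> N" for a b
      unfolding classical_prime_def using le_residual_iff[of _ N "a * b"] by blast
    then show "\<forall>a b. residual smult N (a * b) = residual smult N a \<or>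
        residual smult N (a * b) = residual smult N b"
      by (simp add: *)
  next
    assume res: "\<forall>a b. residual smult N (a * b) = residual smult N a \<or>
        residual smult N (a * b) = residual smult N b"
    \<comment> \<open>By the adjunction \<open>K\<close> lies below the residual at
      \<open>a * b\<close>, which equals the one at \<open>a\<close> or at \<open>b\<close>.\<close>
    have "a \<cdot> K \<le> N \<or> b \<cdot> K \<le> N" if "(a * b) \<cdot> K \<le> N" for a b K
      using that res[rule_format, of a b] by (auto simp: le_residual_iff[symmetric])
    then show "classical_prime smult N"
      using assms unfolding classical_prime_def by blast
  qed
qed

end

text \<open>Writing \<open>a\<close> and \<open>K\<close> as joins of compact elements makes
  \<open>smult a K\<close> the join of the products of these elements. Read contrapositively, the
  rule yields compact witnesses when \<open>smult a K \<le> N\<close> fails.\<close>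

lemma (in cg_L_module) smult_le_compactI:
  fixes a :: 'l
  assumes "compactly_generated TYPE('l)"
    and le: "\<And>r A. compact_elem r \<Longrightarrow> compact_elem A \<Longrightarrow> r \<le> a \<Longrightarrow> A \<le> K \<Longrightarrow> smult r A \<le> N"
  shows "smult a K \<le> N"
proof -
  obtain R where R: "\<And>r. r \<in> R \<Longrightarrow> compact_elem r" "a = Sup R"
    using assms(1)[unfolded compactly_generated_def, rule_format, of a] by auto
  obtain Y where Y: "\<And>A. A \<in> Y \<Longrightarrow> compact_elem A" "K = Sup Y"
    using module_compactly_generated[unfolded compactly_generated_def, rule_format, of K] by auto
  have "smult r A \<le> N" if "r \<in> R" "A \<in> Y" for r A
    using that R Y by (auto intro: le Sup_upper)
  then show ?thesis
    unfolding R(2) Y(2) Sup_smult smult_Sup by (auto intro!: Sup_least)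
qed

lemma (in cg_L_module) classical_prime_iff_compact:
  assumes cg: "compactly_generated TYPE('l)" and "proper_elem N"
  shows "classical_prime smult N \<longleftrightarrow>
    (\<forall>r s K. compact_elem r \<and> compact_elem s \<and> compact_elem K \<and> smult (r * s) K \<le> N \<longrightarrow>
             smult r K \<le> N \<or> smult s K \<le> N)" (is "_ \<longleftrightarrow> ?compact")
proof
  show ?compact if "classical_prime smult N"
    using that unfolding classical_prime_def by blast
next
  assume compact: ?compact
  have "smult a K \<le> N \<or> smult b K \<le> N" if abK: "smult (a * b) K \<le> N" for a b K
  proof (rule ccontr)
    assume "\<not> ?thesis"
    \<comment> \<open>Each of the two failing bounds supplies one pair of witnesses, with possibly
      different module elements \<open>A\<close> and \<open>B\<close>.\<close>
    then obtain r A s B where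
      rA: "compact_elem r" "compact_elem A" "r \<le> a" "A \<le> K" "\<not> smult r A \<le> N" and
      sB: "compact_elem s" "compact_elem B" "s \<le> b" "B \<le> K" "\<not> smult s B \<le> N"
      using smult_le_compactI[OF cg] by metis
    have "smult (r * s) (sup A B) \<le> smult (a * b) K"
      unfolding mult_smult using rA sB by (intro smult_mono) simp_all
    also note abK
    finally have "smult r (sup A B) \<le> N \<or> smult s (sup A B) \<le> N"
      using compact rA(1) sB(1) compact_elem_sup[OF rA(2) sB(2)] by blast
    \<comment> \<open>Since \<open>smult r (sup A B)\<close> lies above \<open>smult r A\<close>,
      and likewise for \<open>s\<close> and \<open>B\<close>, either bound contradicts the choice of
      a witness.\<close>
    then show False using rA sB by (simp add: smult_sup)
  qed
  then show "classical_prime smult N"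
    using assms(2) unfolding classical_prime_def by blast
qed

theorem theorem3p11:
  fixes smult :: "'l::cg_multiplicative_lattice \<Rightarrow> 'm::complete_lattice \<Rightarrow> 'm"  (infixr \<open>\<cdot>\<close> 75)
    and N :: 'm
  assumes "cg_L_module smult"
    and "proper_elem N"
  shows "(classical_prime smult N \<longleftrightarrow>
            (\<forall>a b. residual smult N (a * b) = residual smult N a \<or>
                   residual smult N (a * b) = residual smult N b))
       \<and> ((\<forall>a b. residual smult N (a * b) = residual smult N a \<or>
                   residual smult N (a * b) = residual smult N b) \<longleftrightarrow>
            (\<forall>r s K. compact_elem r \<and> compact_elem s \<and> compact_elem K \<and> (r * s) \<cdot> K \<le> N \<longrightarrow>
                     r \<cdot> K \<le> N \<or> s \<cdot> K \<le> N))"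
proof -
  interpret cg_L_module smult by fact
  show ?thesis
    \<comment> \<open>The equivalence of (2) and (3) passes through (1); the class of
      \<open>'l\<close> supplies its compact generation.\<close>
    using classical_prime_iff_residual[OF assms(2)]
      classical_prime_iff_compact[OF compactly_generated assms(2)]
    by blast
qed

end
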